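(* Let $F:\mathbb D\to\mathbb D^n$ be harmonic with $F(0)=p=(p_1,\ldots,p_n)$, and suppose that $$\|dF_0\|=\left(\sum_{j=1}^n\mathcal M(|p_j|)^2\right)^{1/2}.$$ Then there are $\alpha\in\mathbb R$ and a nonzero vector $W=(W_1,\ldots,W_n)\in\mathbb C^n$ such that $$dF_0(e^{i\theta})=W\cos(\theta-\alpha),\qquad\theta\in\mathbb R,$$ and $|W_j|=\mathcal M(|p_j|)$ for $j=1,\ldots,n$. Consequently, the real differential $dF_0$ has one-dimensional image.
   Context: $\mathbb D=\{z\in\mathbb C:|z|<1\}$. Harmonic maps into $\mathbb C^n\simeq\mathbb R^{2n}$ are understood componentwise. $dF_0:\mathbb R^2\simeq\mathbb C\to\mathbb R^{2n}\simeq\mathbb C^n$ is the real differential and $\|dF_0\|$ its operator norm for the Euclidean norms. The function $\mathcal M:[0,1)\to(0,\infty)$ is given by $\mathcal M(0)=4/\pi$ and, for $0<r<1$, $$\mathcal M(r)=2\int_0^{2\pi}\frac{\cos^2t}{\sqrt{\lambda(r)^2+\cos^2t}}\,\frac{dt}{2\pi},$$ where $\lambda(r)>0$ is the unique positive solution of $$r=\int_0^{2\pi}\frac{\lambda(r)}{\sqrt{\lambda(r)^2+\cos^2t}}\,\frac{dt}{2\pi}.$$ *)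

theory Defs
  imports "HOL-Analysis.Analysis"
begin

definition dir_deriv :: "complex \<Rightarrow> (complex \<Rightarrow> real) \<Rightarrow> complex \<Rightarrow> real" where
  "dir_deriv v u z = frechet_derivative u (at z) v"

text \<open>The real plane is identified with the complex plane, so the coordinate directions
  are \<open>1\<close> and \<open>\<i>\<close>.\<close>

definition C2_on :: "complex set \<Rightarrow> (complex \<Rightarrow> real) \<Rightarrow> bool" where
  "C2_on U u \<longleftrightarrow>
     (\<forall>z\<in>U. u differentiable (at z)) \<and>
     (\<forall>v\<in>{1, \<i>}. \<forall>z\<in>U. dir_deriv v u differentiable (at z)) \<and>
     (\<forall>v\<in>{1, \<i>}. \<forall>w\<in>{1, \<i>}. continuous_on U (dir_deriv w (dir_deriv v u)))"

definition laplacian :: "(complex \<Rightarrow> real) \<Rightarrow> complex \<Rightarrow> real" where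
  "laplacian u z = dir_deriv 1 (dir_deriv 1 u) z + dir_deriv \<i> (dir_deriv \<i> u) z"

definition harmonic_on :: "complex set \<Rightarrow> (complex \<Rightarrow> real) \<Rightarrow> bool" where
  "harmonic_on U u \<longleftrightarrow> open U \<and> C2_on U u \<and> (\<forall>z\<in>U. laplacian u z = 0)"

definition harmonic_map_on :: "complex set \<Rightarrow> (complex \<Rightarrow> complex ^ 'n) \<Rightarrow> bool" where
  "harmonic_map_on U F \<longleftrightarrow>
     (\<forall>j. harmonic_on U (\<lambda>z. Re (F z $ j)) \<and> harmonic_on U (\<lambda>z. Im (F z $ j)))"

definition unit_disc :: "complex set" where
  "unit_disc = {z. cmod z < 1}"

definition unit_polydisc :: "(complex ^ 'n) set" where
  "unit_polydisc = {w. \<forall>j. w $ j \<in> unit_disc}"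

text \<open>Meaningful for \<open>0 < r < 1\<close>, where the positive solution exists and is unique.\<close>

definition lambda_of :: "real \<Rightarrow> real" where
  "lambda_of r = (THE l. l > 0 \<and>
     r = integral {0..2 * pi} (\<lambda>t. l / sqrt (l\<^sup>2 + (cos t)\<^sup>2) / (2 * pi)))"

text \<open>Meaningful for \<open>0 \<le> r < 1\<close>.\<close>

definition M_fun :: "real \<Rightarrow> real" where
  "M_fun r = (if r = 0 then 4 / pi
     else 2 * integral {0..2 * pi}
       (\<lambda>t. (cos t)\<^sup>2 / sqrt ((lambda_of r)\<^sup>2 + (cos t)\<^sup>2) / (2 * pi)))"

end

theory Submission
  imports Defs "HOL-Real_Asymp.Real_Asymp" "HOL-Complex_Analysis.Cauchy_Integral_Formula"
begin

text \<open>
  Let \<open>f\<close> be one component, \<open>A\<close> and \<open>B\<close> its derivatives at \<open>0\<close> in the orthonormal directions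
  \<open>cis \<alpha>\<close> and \<open>\<i> * cis \<alpha>\<close>. On the circle of radius \<open>\<rho> < 1\<close> the function
  \<open>g t = f (\<rho> * cis (\<alpha> + t))\<close> has mean \<open>f 0\<close>, and its first Fourier coefficients are given by
  \<open>\<rho> A\<close> and \<open>\<rho> B\<close>. Boundary values are avoided by a duality argument: since \<open>norm (g t) \<le> 1\<close>,
  pairing \<open>g\<close> with \<open>k t = l e + cos t a + s sin t b\<close>, where \<open>a\<close>, \<open>b\<close>, \<open>e\<close> are unit vectors and \<open>e\<close>
  is parallel to \<open>f 0\<close>, gives at most the integral of \<open>norm (k t)\<close>, which by symmetry is at
  most the integral of \<open>sqrt (l\<^sup>2 + cos\<^sup>2 t + s\<^sup>2 sin\<^sup>2 t)\<close>. With \<open>l = \<lambda>(norm (f 0))\<close> and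
  \<open>\<rho> \<longlongrightarrow> 1\<close> this becomes \<open>a \<bullet> A + s (b \<bullet> B) \<le> M (norm (f 0)) + o(s)\<close> as \<open>s \<longlongrightarrow> 0\<close>. Hence
  \<open>norm A \<le> M (norm (f 0))\<close>, and equality forces \<open>B = 0\<close>. If \<open>cis \<alpha>\<close> is a direction in which the
  operator norm is attained, equality holds in every component.
\<close>

subsection \<open>The functions \<open>\<lambda>\<close> and \<open>M\<close>\<close>

lemma sqrt_sum_squares_pos: "0 < (l::real) \<Longrightarrow> 0 < sqrt (l\<^sup>2 + x\<^sup>2)"
  by (smt (verit) real_sqrt_gt_zero sum_squares_gt_zero_iff zero_le_power2 zero_less_power)

text \<open>This is the right-hand side of the equation that defines \<open>\<lambda>\<close>, so
  that \<open>lambda_of\<close> inverts it. With \<open>l = s\<close> it also measures the error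
  term of the duality estimate.\<close>

definition I_fun :: "real \<Rightarrow> real" where
  "I_fun l = integral {0..2 * pi} (\<lambda>t. l / sqrt (l\<^sup>2 + (cos t)\<^sup>2)) / (2 * pi)"

lemma I_integrable: "0 < l \<Longrightarrow> (\<lambda>t. l / sqrt (l\<^sup>2 + (cos t)\<^sup>2)) integrable_on {a..b}"
  by (intro integrable_continuous_interval continuous_intros)
     (use sqrt_sum_squares_pos in \<open>force simp: less_imp_neq\<close>)

text \<open>Dominated convergence: the integrands lie between 0 and 1 and tend to 0 off the zeros of
  the cosine. The limit is used twice, for the existence of \<open>lambda_of r\<close> when
  \<open>r\<close> is small and for an error of order o(s) in the duality estimate.\<close>

lemma I_fun_seq_tendsto_0: "(\<lambda>n. I_fun (1 / real (Suc n))) \<longlonglongrightarrow> 0"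
proof -
  let ?f = "\<lambda>n t. (1 / real (Suc n)) / sqrt ((1 / real (Suc n))\<^sup>2 + (cos t)\<^sup>2)"
  \<comment> \<open>On the zeros of the cosine the integrands are constantly 1, so the pointwise
    limit is the indicator function of a countable set.\<close>
  let ?g = "\<lambda>t::real. if cos t = 0 then 1 else 0 :: real"
  have "(\<lambda>n. integral {0..2*pi} (?f n)) \<longlonglongrightarrow> integral {0..2*pi} ?g"
  proof (rule dominated_convergence(2))
    show "?f n integrable_on {0..2*pi}" for n by (rule I_integrable) simp
    show "(\<lambda>_. 1::real) integrable_on {0..2*pi}" by (rule integrable_const_ivl)
    show "norm (?f n t) \<le> 1" for n t
    proof -
      have "1 / real (Suc n) \<le> sqrt ((1 / real (Suc n))\<^sup>2 + (cos t)\<^sup>2)"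
        by (rule real_le_rsqrt) simp
      moreover have "0 < sqrt ((1 / real (Suc n))\<^sup>2 + (cos t)\<^sup>2)"
        by (rule sqrt_sum_squares_pos) simp
      ultimately have "?f n t \<le> 1" "0 \<le> ?f n t" by (simp_all only: divide_le_eq_1_pos) simp
      then show ?thesis by (simp only: real_norm_def abs_of_nonneg)
    qed
    show "(\<lambda>n. ?f n t) \<longlonglongrightarrow> ?g t" for t
    proof (cases "cos t = 0")
      case True
      then show ?thesis by (simp add: real_sqrt_abs del: of_nat_Suc)
    next
      case False
      have 1: "(\<lambda>n. 1 / real (Suc n)) \<longlonglongrightarrow> 0" by (rule lim_1_over_n[THEN LIMSEQ_Suc])
      have "(\<lambda>n. ?f n t) \<longlonglongrightarrow> 0 / sqrt (0\<^sup>2 + (cos t)\<^sup>2)"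
        by (intro tendsto_intros 1) (use False in simp)
      with False show ?thesis by simp
    qed
  qed
  moreover have "integral {0..2*pi} ?g = 0"
  proof -
    have "{t. cos t = (0::real)} \<subseteq> range (\<lambda>i. of_int i * pi + pi / 2)"
      by (auto simp: cos_zero_iff_int2)
    then have "countable {t. cos t = (0::real)}"
      by (meson countable_subset countable_image countableI_type)
    then have "negligible {t. cos t = (0::real)}"
      unfolding negligible_iff_null_sets
      by (intro null_sets_completionI countable_imp_null_set_lborel)
    then have "integral {0..2*pi} ?g = integral {0..2*pi} (\<lambda>_. 0)"
      by (rule integral_spike) auto
    then show ?thesis by simp
  qed
  ultimately have "(\<lambda>n. integral {0..2*pi} (?f n) / (2*pi)) \<longlonglongrightarrow> 0 / (2*pi)"
    by (intro tendsto_intros) auto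
  then show ?thesis unfolding I_fun_def by simp
qed

text \<open>The integrands increase with \<open>l\<close> at every \<open>t\<close>, so it remains
  to exclude equal integrals. A continuous nonnegative difference with integral 0 would vanish
  everywhere, which fails at \<open>t = 0\<close>.\<close>

lemma I_fun_strict_mono:
  assumes "0 < a" "a < b"
  shows "I_fun a < I_fun b"
proof -
  let ?f = "\<lambda>l t::real. l / sqrt (l\<^sup>2 + (cos t)\<^sup>2)"
  have le: "?f a t \<le> ?f b t" for t
  proof -
    have p: "0 < sqrt (a\<^sup>2 + (cos t)\<^sup>2)" "0 < sqrt (b\<^sup>2 + (cos t)\<^sup>2)"
      using sqrt_sum_squares_pos assms by auto
    have "a * sqrt (b\<^sup>2 + (cos t)\<^sup>2) \<le> b * sqrt (a\<^sup>2 + (cos t)\<^sup>2)"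
    proof (rule power2_le_imp_le)
      have "a\<^sup>2 * (cos t)\<^sup>2 \<le> b\<^sup>2 * (cos t)\<^sup>2"
        using assms by (intro mult_right_mono power_mono) auto
      then show "(a * sqrt (b\<^sup>2 + (cos t)\<^sup>2))\<^sup>2 \<le> (b * sqrt (a\<^sup>2 + (cos t)\<^sup>2))\<^sup>2"
        by (simp add: power_mult_distrib algebra_simps)
    qed (use assms in simp)
    then show ?thesis using p by (simp add: field_simps)
  qed
  have cont: "continuous_on {0..2*pi} (\<lambda>t. ?f b t - ?f a t)"
    by (intro continuous_intros; use sqrt_sum_squares_pos assms in \<open>force simp: less_imp_neq\<close>)
  have ne: "integral {0..2*pi} (\<lambda>t. ?f b t - ?f a t) \<noteq> 0"
  proof
    assume z: "integral {0..2*pi} (\<lambda>t. ?f b t - ?f a t) = 0"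
    have "((\<lambda>t. ?f b t - ?f a t) has_integral 0) (cbox 0 (2*pi))"
      using integrable_integral[OF integrable_continuous_interval[OF cont]] z by simp
    then have "?f b 0 - ?f a 0 = 0"
      by (rule has_integral_0_cbox_imp_0[rotated 2]) (use cont le pi_gt_zero in \<open>auto simp del: pi_gt_zero\<close>)
    moreover have "?f a 0 < ?f b 0"
    proof -
      have "a * sqrt (b\<^sup>2 + 1) < b * sqrt (a\<^sup>2 + 1)"
        by (rule power2_less_imp_less)
           (use assms in \<open>simp_all add: power_mult_distrib algebra_simps power_strict_mono\<close>)
      then show ?thesis
        using sqrt_sum_squares_pos[of a 1] sqrt_sum_squares_pos[of b 1] assms
        by (simp add: field_simps)
    qed
    ultimately show False by simp
  qed
  moreover have "0 \<le> integral {0..2*pi} (\<lambda>t. ?f b t - ?f a t)"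
    by (rule integral_nonneg[OF integrable_continuous_interval[OF cont]]) (use le in auto)
  moreover have "integral {0..2*pi} (\<lambda>t. ?f b t - ?f a t) = integral {0..2*pi} (?f b) - integral {0..2*pi} (?f a)"
    by (rule integral_diff) (use I_integrable assms in auto)
  ultimately show ?thesis unfolding I_fun_def by (simp add: divide_strict_right_mono)
qed

lemma continuous_on_I_fun: "continuous_on {0<..} I_fun"
proof -
  have "continuous_on {0<..} (\<lambda>l. integral (cbox 0 (2*pi)) (\<lambda>t. l / sqrt (l\<^sup>2 + (cos t)\<^sup>2)))"
    by (rule integral_continuous_on_param)
       (auto intro!: continuous_intros simp: case_prod_unfold dest: sqrt_sum_squares_pos
             simp: add_nonneg_eq_0_iff)
  then show ?thesis unfolding I_fun_def by (intro continuous_intros) (auto simp: cbox_interval)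
qed

text \<open>The cosine has absolute value at most 1. The lower bound tends to 1 as \<open>l\<close>
  grows, so \<open>I_fun\<close> gets above every \<open>r < 1\<close>.\<close>

lemma I_fun_ge:
  assumes "0 < l"
  shows "l / sqrt (l\<^sup>2 + 1) \<le> I_fun l"
proof -
  have "integral {0..2*pi} (\<lambda>t. l / sqrt (l\<^sup>2 + 1)) \<le> integral {0..2*pi} (\<lambda>t. l / sqrt (l\<^sup>2 + (cos t)\<^sup>2))"
  proof (rule integral_le)
    fix t :: real
    have "sqrt (l\<^sup>2 + (cos t)\<^sup>2) \<le> sqrt (l\<^sup>2 + 1)"
      using abs_square_le_1[of "cos t"] by simp
    then show "l / sqrt (l\<^sup>2 + 1) \<le> l / sqrt (l\<^sup>2 + (cos t)\<^sup>2)"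
      using sqrt_sum_squares_pos[OF assms, of "cos t"] assms by (intro divide_left_mono) auto
  qed (use I_integrable assms in auto)
  then have "2*pi * (l / sqrt (l\<^sup>2 + 1)) \<le> integral {0..2*pi} (\<lambda>t. l / sqrt (l\<^sup>2 + (cos t)\<^sup>2))"
    by simp
  then show ?thesis unfolding I_fun_def by (simp add: field_simps)
qed

text \<open>The intermediate value theorem between a small and a large argument gives a solution,
  and strict monotonicity makes it the only one. Together they evaluate the definite
  description.\<close>

lemma lambda_of:
  assumes "0 < r" "r < 1"
  shows "0 < lambda_of r" "I_fun (lambda_of r) = r"
proof -
  have eq: "integral {0..2 * pi} (\<lambda>t. l / sqrt (l\<^sup>2 + (cos t)\<^sup>2) / (2 * pi)) = I_fun l" for l
    unfolding I_fun_def by (rule integral_divide)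
  have "eventually (\<lambda>n. I_fun (1 / real (Suc n)) < r) sequentially"
    using order_tendstoD(2)[OF I_fun_seq_tendsto_0 assms(1)] .
  then obtain n where n: "I_fun (1 / real (Suc n)) < r"
    by (auto simp: eventually_sequentially)
  have "((\<lambda>l::real. l / sqrt (l\<^sup>2 + 1)) \<longlongrightarrow> 1) at_top" by real_asymp
  from order_tendstoD(1)[OF this assms(2)]
  have "eventually (\<lambda>l::real. r < l / sqrt (l\<^sup>2 + 1) \<and> 1 < l) at_top"
    by (intro eventually_conj eventually_gt_at_top)
  then obtain b :: real where b: "r < b / sqrt (b\<^sup>2 + 1)" "1 < b"
    by (auto simp: eventually_at_top_linorder)
  have "r \<le> I_fun b" using b I_fun_ge[of b] by simp
  moreover have "1 / real (Suc n) \<le> b" using b(2) by (smt (verit) divide_le_eq_1 of_nat_Suc of_nat_0_le_iff)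
  moreover have "continuous_on {1 / real (Suc n)..b} I_fun"
    by (rule continuous_on_subset[OF continuous_on_I_fun])
       (auto intro: less_le_trans[of 0 "1 / real (Suc n)"])
  ultimately obtain l where l: "1 / real (Suc n) \<le> l" "I_fun l = r"
    using IVT'[of I_fun "1 / real (Suc n)" r b] n by auto
  have "0 < l" using l(1) by (smt (verit) of_nat_0_less_iff zero_less_Suc zero_less_divide_1_iff)
  have "lambda_of r = l" unfolding lambda_of_def eq
  proof (rule the_equality)
    show "l' = l" if "l' > 0 \<and> r = I_fun l'" for l'
      using that l(2) \<open>0 < l\<close> I_fun_strict_mono by (metis linorder_neqE_linordered_idom order_less_irrefl)
  qed (use \<open>0 < l\<close> l in auto)
  then show "0 < lambda_of r" "I_fun (lambda_of r) = r" using \<open>0 < l\<close> l(2) by auto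
qed

text \<open>For \<open>l = 0\<close> the weight \<open>sqrt (l\<^sup>2 + (cos t)\<^sup>2)\<close> is
  \<open>\<bar>cos t\<bar>\<close>; its integral accounts for the value \<open>4 / pi\<close> of
  \<open>M_fun\<close> at 0.\<close>

lemma integral_abs_cos: "integral {0..2*pi} (\<lambda>t. \<bar>cos t\<bar>) = 4"
proof -
  have a: "((\<lambda>t. \<bar>cos t\<bar>) has_integral (sin (pi/2) - sin 0)) {0..pi/2}"
  proof -
    have "(cos has_integral (sin (pi/2) - sin 0)) {0..pi/2}"
      by (rule fundamental_theorem_of_calculus)
         (auto intro!: derivative_eq_intros simp: has_real_derivative_iff_has_vector_derivative[symmetric])
    then show ?thesis
      by (rule has_integral_eq[rotated]) (use cos_ge_zero in force)
  qed
  have b: "((\<lambda>t. \<bar>cos t\<bar>) has_integral (- sin (3*pi/2) - - sin (pi/2))) {pi/2..3*pi/2}"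
  proof -
    have "((\<lambda>t. - cos t) has_integral (- sin (3*pi/2) - - sin (pi/2))) {pi/2..3*pi/2}"
      by (rule fundamental_theorem_of_calculus)
         (auto intro!: derivative_eq_intros simp: has_real_derivative_iff_has_vector_derivative[symmetric])
    moreover have "cos t \<le> 0" if "t \<in> {pi/2..3*pi/2}" for t
      using cos_ge_zero[of "t - pi"] that by (simp add: cos_diff)
    ultimately show ?thesis
      by (elim has_integral_eq[rotated]) simp
  qed
  have c: "((\<lambda>t. \<bar>cos t\<bar>) has_integral (sin (2*pi) - sin (3*pi/2))) {3*pi/2..2*pi}"
  proof -
    have "(cos has_integral (sin (2*pi) - sin (3*pi/2))) {3*pi/2..2*pi}"
      by (rule fundamental_theorem_of_calculus)
         (auto intro!: derivative_eq_intros simp: has_real_derivative_iff_has_vector_derivative[symmetric])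
    moreover have "0 \<le> cos t" if "t \<in> {3*pi/2..2*pi}" for t
      using cos_ge_zero[of "t - 2*pi"] that by (simp add: cos_diff)
    ultimately show ?thesis
      by (elim has_integral_eq[rotated]) simp
  qed
  have s: "sin (3*pi/2) = -1" using sin_3over2_pi by (simp add: mult.commute)
  have "((\<lambda>t. \<bar>cos t\<bar>) has_integral (1 + 2)) {0..3*pi/2}"
    by (rule has_integral_combine[OF _ _ a[simplified] b[simplified s, simplified]]) auto
  from has_integral_combine[OF _ _ this c[simplified s]] show ?thesis
    by (intro integral_unique) simp
qed

text \<open>With \<open>X = l\<^sup>2 + (cos t)\<^sup>2\<close>, integrate
  \<open>sqrt X = (cos t)\<^sup>2 / sqrt X + l * (l / sqrt X)\<close>: the first summand yields
  \<open>M_fun r\<close>, the second yields \<open>r\<close> by the choice of \<open>l\<close>. In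
  the duality estimate the right-hand side bounds the pairing, and \<open>2 * l * r\<close> is the
  share of the mean value. For \<open>r = 0\<close> the multiplier is \<open>l = 0\<close>.\<close>

lemma M_fun_lambda:
  assumes "0 \<le> r" "r < 1"
  obtains l where "0 \<le> l" 
    "M_fun r + 2 * l * r = integral {0..2*pi} (\<lambda>t. sqrt (l\<^sup>2 + (cos t)\<^sup>2)) / pi"
proof (cases "r = 0")
  case True
  show ?thesis
    by (rule that[of 0]) (use True integral_abs_cos in \<open>simp_all add: M_fun_def\<close>)
next
  case False
  define l where "l = lambda_of r"
  have l: "0 < l" "I_fun l = r" using lambda_of[of r] assms False by (auto simp: l_def)
  have [simp]: "l \<noteq> 0" using l by simp
  have i: "(\<lambda>t. (cos t)\<^sup>2 / sqrt (l\<^sup>2 + (cos t)\<^sup>2)) integrable_on {0..2*pi}"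
    by (intro integrable_continuous_interval continuous_intros) auto
  have "integral {0..2*pi} (\<lambda>t. sqrt (l\<^sup>2 + (cos t)\<^sup>2))
     = integral {0..2*pi} (\<lambda>t. (cos t)\<^sup>2 / sqrt (l\<^sup>2 + (cos t)\<^sup>2) + l * (l / sqrt (l\<^sup>2 + (cos t)\<^sup>2)))"
  proof (rule integral_cong)
    fix t
    have "(cos t)\<^sup>2 / sqrt (l\<^sup>2 + (cos t)\<^sup>2) + l * (l / sqrt (l\<^sup>2 + (cos t)\<^sup>2))
       = (l\<^sup>2 + (cos t)\<^sup>2) / sqrt (l\<^sup>2 + (cos t)\<^sup>2)"
      by (simp add: add_divide_distrib power2_eq_square)
    also have "\<dots> = sqrt (l\<^sup>2 + (cos t)\<^sup>2)" by (simp add: real_div_sqrt)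
    finally show "sqrt (l\<^sup>2 + (cos t)\<^sup>2) = (cos t)\<^sup>2 / sqrt (l\<^sup>2 + (cos t)\<^sup>2) + l * (l / sqrt (l\<^sup>2 + (cos t)\<^sup>2))" ..
  qed
  also have "\<dots> = integral {0..2*pi} (\<lambda>t. (cos t)\<^sup>2 / sqrt (l\<^sup>2 + (cos t)\<^sup>2))
      + l * integral {0..2*pi} (\<lambda>t. l / sqrt (l\<^sup>2 + (cos t)\<^sup>2))"
    using i I_integrable[OF l(1)] by (subst integral_add) (auto simp del: times_divide_eq_right)
  also have "integral {0..2*pi} (\<lambda>t. l / sqrt (l\<^sup>2 + (cos t)\<^sup>2)) = 2 * pi * r"
    using l(2) unfolding I_fun_def by (simp add: field_simps)
  finally have "integral {0..2*pi} (\<lambda>t. sqrt (l\<^sup>2 + (cos t)\<^sup>2)) / pi = M_fun r + 2 * l * r"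
    using False unfolding M_fun_def l_def[symmetric] integral_divide by (simp add: field_simps)
  with l(1) show ?thesis by (intro that[of l]) auto
qed

text \<open>For \<open>r \<noteq> 0\<close> the integrand is continuous, nonnegative and positive at
  \<open>t = 0\<close>. Positivity is what makes the extremal vector nonzero.\<close>

lemma M_fun_pos:
  assumes "0 \<le> r" "r < 1"
  shows "0 < M_fun r"
proof (cases "r = 0")
  case False
  define l where "l = lambda_of r"
  have l: "0 < l" using lambda_of[of r] assms False by (auto simp: l_def)
  have [simp]: "l \<noteq> 0" using l by simp
  let ?f = "\<lambda>t. (cos t)\<^sup>2 / sqrt (l\<^sup>2 + (cos t)\<^sup>2) / (2 * pi)"
  have c: "continuous_on {0..2*pi} ?f" by (intro continuous_intros) auto
  have "integral {0..2*pi} ?f \<noteq> 0"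
  proof
    assume "integral {0..2*pi} ?f = 0"
    then have "(?f has_integral 0) (cbox 0 (2*pi))"
      using integrable_integral[OF integrable_continuous_interval[OF c]] by simp
    then have "?f 0 = 0"
      by (rule has_integral_0_cbox_imp_0[rotated 2]) (use c pi_gt_zero in \<open>auto simp del: pi_gt_zero\<close>)
    then show False using sqrt_sum_squares_pos[OF l(1), of 1] by simp
  qed
  moreover have "0 \<le> integral {0..2*pi} ?f"
    by (rule integral_nonneg[OF integrable_continuous_interval[OF c]]) auto
  ultimately show ?thesis using False unfolding M_fun_def l_def by simp
qed (simp add: M_fun_def)

subsection \<open>Harmonic functions as real parts of holomorphic functions\<close>

text \<open>The mean value theorem in direction \<open>v\<close> reduces the second difference to an
  increment of \<open>dir_deriv v u\<close> in direction \<open>w\<close>, and differentiability of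
  \<open>dir_deriv v u\<close> at \<open>z\<close> linearises that increment.\<close>

lemma second_difference_estimate:
  fixes u :: "complex \<Rightarrow> real"
  assumes "open U" "z \<in> U" and u: "\<And>x. x \<in> U \<Longrightarrow> u differentiable (at x)"
    and d: "dir_deriv v u differentiable (at z)" and "0 < e"
  obtains d where "0 < d" "\<And>h. \<lbrakk>0 < h; h < d\<rbrakk> \<Longrightarrow>
    \<bar>u (z + h *\<^sub>R v + h *\<^sub>R w) - u (z + h *\<^sub>R v) - u (z + h *\<^sub>R w) + u z
       - h\<^sup>2 * dir_deriv w (dir_deriv v u) z\<bar> \<le> e * h\<^sup>2"
proof -
  define a where "a = dir_deriv v u"
  define L where "L = frechet_derivative a (at z)"
  have L: "(a has_derivative L) (at z)"
    using d unfolding L_def a_def frechet_derivative_works .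
  interpret L: bounded_linear L using L by (rule has_derivative_bounded_linear)
  \<comment> \<open>Two first-order errors, each at most
    \<open>e / N * (h * (norm v + norm w))\<close>, must add up to at most \<open>e * h\<close>. The
    summand 1 keeps \<open>N\<close> positive when \<open>v\<close> and \<open>w\<close>
    vanish.\<close>
  define N where "N = 2 * (norm v + norm w) + 1"
  have N: "0 < N" unfolding N_def by (simp add: add_nonneg_pos)
  have "0 < e / N" using N \<open>0 < e\<close> by simp
  then obtain d1 where d1: "0 < d1"
    "\<And>y. norm (y - z) < d1 \<Longrightarrow> norm (a y - a z - L (y - z)) \<le> e / N * norm (y - z)"
    using L unfolding has_derivative_at_alt by metis
  obtain d2 where d2: "0 < d2" "ball z d2 \<subseteq> U"
    using assms(1,2) open_contains_ball by blast
  define d where "d = min d1 d2 / N"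
  have "0 < d" using d1 d2 N by (simp add: d_def)
  have est: "\<bar>u (z + h *\<^sub>R v + h *\<^sub>R w) - u (z + h *\<^sub>R v) - u (z + h *\<^sub>R w) + u z
       - h\<^sup>2 * dir_deriv w (dir_deriv v u) z\<bar> \<le> e * h\<^sup>2" if h: "0 < h" "h < d" for h
  proof -
    have hN: "h * N < min d1 d2" using h(2) N by (simp add: d_def field_simps)
    have small: "norm (x *\<^sub>R v + y *\<^sub>R w) \<le> h * (norm v + norm w)"
      if "0 \<le> x" "x \<le> h" "0 \<le> y" "y \<le> h" for x y
    proof -
      have "norm (x *\<^sub>R v + y *\<^sub>R w) \<le> x * norm v + y * norm w"
        using norm_triangle_ineq[of "x *\<^sub>R v" "y *\<^sub>R w"] that by simp
      also have "\<dots> \<le> h * norm v + h * norm w"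
        using that by (intro add_mono mult_right_mono) auto
      finally show ?thesis by (simp add: algebra_simps)
    qed
    have lt: "h * (norm v + norm w) < min d1 d2"
    proof -
      have "h * (norm v + norm w) \<le> h * N"
        using h by (intro mult_left_mono) (auto simp: N_def)
      with hN show ?thesis by simp
    qed
    have inU: "z + x *\<^sub>R v + y *\<^sub>R w \<in> U"
      if "0 \<le> x" "x \<le> h" "0 \<le> y" "y \<le> h" for x y
    proof -
      have "dist z (z + x *\<^sub>R v + y *\<^sub>R w) = norm (x *\<^sub>R v + y *\<^sub>R w)"
        by (subst dist_commute) (simp add: dist_norm add.assoc)
      with small[OF that] lt d2(2) show ?thesis by (auto simp: subset_iff)
    qed
    \<comment> \<open>The second difference is \<open>\<phi> h - \<phi> 0\<close>.\<close>
    define \<phi> where "\<phi> x = u (z + x *\<^sub>R v + h *\<^sub>R w) - u (z + x *\<^sub>R v)" for x :: real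
    have der: "(\<phi> has_field_derivative (a (z + x *\<^sub>R v + h *\<^sub>R w) - a (z + x *\<^sub>R v))) (at x)"
      if "0 \<le> x" "x \<le> h" for x
    proof -
      have *: "((\<lambda>x. u (z + x *\<^sub>R v + y)) has_field_derivative a (z + x *\<^sub>R v + y)) (at x)"
        if y: "z + x *\<^sub>R v + y \<in> U" for y
      proof -
        let ?D = "frechet_derivative u (at (z + x *\<^sub>R v + y))"
        have D: "(u has_derivative ?D) (at (z + x *\<^sub>R v + y))"
          using u[OF y] by (simp add: frechet_derivative_works)
        then interpret D: bounded_linear ?D by (rule has_derivative_bounded_linear)
        have "((\<lambda>x. z + x *\<^sub>R v + y) has_derivative (\<lambda>t. t *\<^sub>R v)) (at x)"
          by (auto intro!: derivative_eq_intros)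
        from diff_chain_at[OF this D]
        have "((\<lambda>x. u (z + x *\<^sub>R v + y)) has_derivative (\<lambda>t. t * ?D v)) (at x)"
          by (simp add: o_def D.scaleR)
        then show ?thesis
          by (rule has_derivative_imp_has_field_derivative) (simp add: a_def dir_deriv_def)
      qed
      show ?thesis unfolding \<phi>_def
        using *[of "h *\<^sub>R w"] *[of 0] inU[of x h] inU[of x 0] that h
        by (intro DERIV_diff) auto
    qed
    obtain x where x: "0 < x" "x < h"
      "\<phi> h - \<phi> 0 = (h - 0) * (a (z + x *\<^sub>R v + h *\<^sub>R w) - a (z + x *\<^sub>R v))"
      using MVT2[of 0 h \<phi>, OF h(1) der] by auto
    have near: "\<bar>a (z + k) - a z - L k\<bar> \<le> e / N * (h * (norm v + norm w))"
      if "norm k \<le> h * (norm v + norm w)" for k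
    proof -
      have "\<bar>a (z + k) - a z - L k\<bar> \<le> e / N * norm k"
        using d1(2)[of "z + k"] that lt by simp
      also have "\<dots> \<le> e / N * (h * (norm v + norm w))"
        using that \<open>0 < e / N\<close> by (intro mult_left_mono) auto
      finally show ?thesis .
    qed
    have n1: "\<bar>a (z + x *\<^sub>R v + h *\<^sub>R w) - a z - L (x *\<^sub>R v + h *\<^sub>R w)\<bar> \<le> e / N * (h * (norm v + norm w))"
      using near[OF small[of x h]] x h by (simp add: add.assoc)
    have n2: "\<bar>a (z + x *\<^sub>R v) - a z - L (x *\<^sub>R v)\<bar> \<le> e / N * (h * (norm v + norm w))"
      using near[OF small[of x 0]] x h by simp
    have Leq: "L (x *\<^sub>R v + h *\<^sub>R w) - L (x *\<^sub>R v) = h * L w"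
      by (simp add: L.add L.scaleR)
    have "\<bar>a (z + x *\<^sub>R v + h *\<^sub>R w) - a (z + x *\<^sub>R v) - h * L w\<bar> \<le> 2 * (e / N * (h * (norm v + norm w)))"
      using n1 n2 Leq by linarith
    also have "\<dots> = (2 * (norm v + norm w) / N) * (e * h)" by simp
    also have "\<dots> \<le> 1 * (e * h)"
      using N h \<open>0 < e\<close> by (intro mult_right_mono) (auto simp: N_def)
    finally have "h * \<bar>a (z + x *\<^sub>R v + h *\<^sub>R w) - a (z + x *\<^sub>R v) - h * L w\<bar> \<le> h * (e * h)"
      using h by (intro mult_left_mono) auto
    moreover have "h * \<bar>a (z + x *\<^sub>R v + h *\<^sub>R w) - a (z + x *\<^sub>R v) - h * L w\<bar>
        = \<bar>\<phi> h - \<phi> 0 - h\<^sup>2 * L w\<bar>"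
    proof -
      have "\<phi> h - \<phi> 0 - h\<^sup>2 * L w = h * (a (z + x *\<^sub>R v + h *\<^sub>R w) - a (z + x *\<^sub>R v) - h * L w)"
        using x(3) by (simp add: algebra_simps power2_eq_square)
      then show ?thesis using h by (simp add: abs_mult)
    qed
    ultimately have "\<bar>\<phi> h - \<phi> 0 - h\<^sup>2 * L w\<bar> \<le> e * h\<^sup>2"
      by (simp add: power2_eq_square algebra_simps)
    moreover have "L w = dir_deriv w (dir_deriv v u) z"
      by (simp add: L_def a_def dir_deriv_def[of w])
    ultimately show ?thesis by (simp add: \<phi>_def algebra_simps)
  qed
  show ?thesis using that[OF \<open>0 < d\<close> est] .
qed

text \<open>Schwarz's theorem: the second difference in the estimate above is symmetric in \<open>v\<close> and \<open>w\<close>.\<close>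

lemma dir_deriv_commute:
  fixes u :: "complex \<Rightarrow> real"
  assumes U: "open U" "z \<in> U" "\<And>x. x \<in> U \<Longrightarrow> u differentiable (at x)"
    and d: "dir_deriv v u differentiable (at z)" "dir_deriv w u differentiable (at z)"
  shows "dir_deriv w (dir_deriv v u) z = dir_deriv v (dir_deriv w u) z" (is "?P = ?Q")
proof -
  have "\<bar>?P - ?Q\<bar> \<le> 0 + e" if "0 < e" for e
  proof -
    have e2: "0 < e / 2" using that by simp
    obtain d1 where d1: "0 < d1" "\<And>h. \<lbrakk>0 < h; h < d1\<rbrakk> \<Longrightarrow>
      \<bar>u (z + h *\<^sub>R v + h *\<^sub>R w) - u (z + h *\<^sub>R v) - u (z + h *\<^sub>R w) + u z - h\<^sup>2 * ?P\<bar> \<le> e / 2 * h\<^sup>2"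
      using second_difference_estimate[OF U d(1) e2, of w] by blast
    obtain d2 where d2: "0 < d2" "\<And>h. \<lbrakk>0 < h; h < d2\<rbrakk> \<Longrightarrow>
      \<bar>u (z + h *\<^sub>R w + h *\<^sub>R v) - u (z + h *\<^sub>R w) - u (z + h *\<^sub>R v) + u z - h\<^sup>2 * ?Q\<bar> \<le> e / 2 * h\<^sup>2"
      using second_difference_estimate[OF U d(2) e2, of v] by blast
    define h where "h = min d1 d2 / 2"
    have h: "0 < h" "h < d1" "h < d2" using d1 d2 by (auto simp: h_def)
    have "z + h *\<^sub>R w + h *\<^sub>R v = z + h *\<^sub>R v + h *\<^sub>R w" by (simp add: algebra_simps)
    with d1(2)[of h] d2(2)[of h] h have "\<bar>h\<^sup>2 * ?P - h\<^sup>2 * ?Q\<bar> \<le> e / 2 * h\<^sup>2 + e / 2 * h\<^sup>2"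
      by (smt (verit))
    then have "\<bar>h\<^sup>2 * ?P - h\<^sup>2 * ?Q\<bar> \<le> e * h\<^sup>2" by simp
    moreover have "\<bar>h\<^sup>2 * ?P - h\<^sup>2 * ?Q\<bar> = h\<^sup>2 * \<bar>?P - ?Q\<bar>"
      by (simp add: right_diff_distrib[symmetric] abs_mult)
    ultimately show ?thesis using h by (simp add: mult.commute)
  qed
  then have "\<bar>?P - ?Q\<bar> \<le> 0" by (rule field_le_epsilon)
  then show ?thesis by simp
qed

lemma frechet_derivative_eq_dir_deriv:
  fixes u :: "complex \<Rightarrow> real"
  assumes "u differentiable (at z)"
  shows "frechet_derivative u (at z) h = Re h * dir_deriv 1 u z + Im h * dir_deriv \<i> u z"
proof -
  interpret bounded_linear "frechet_derivative u (at z)"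
    using assms by (simp add: frechet_derivative_works has_derivative_bounded_linear)
  have "h = Re h *\<^sub>R 1 + Im h *\<^sub>R \<i>" by (simp add: complex_eq_iff)
  then show ?thesis unfolding dir_deriv_def by (metis add scaleR real_scaleR_def)
qed

text \<open>The function \<open>u_x - \<i> u_y\<close> satisfies the Cauchy-Riemann equations: one
  is Laplace's equation, the other is the symmetry of the mixed second derivatives. Its real
  differential is therefore multiplication by a complex number.\<close>

lemma harmonic_gradient_holomorphic:
  assumes "harmonic_on U u"
  shows "(\<lambda>z. Complex (dir_deriv 1 u z) (- dir_deriv \<i> u z)) holomorphic_on U"
proof -
  have U: "open U" and u: "\<And>z. z \<in> U \<Longrightarrow> u differentiable (at z)"
    and ux: "\<And>z. z \<in> U \<Longrightarrow> dir_deriv 1 u differentiable (at z)"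
    and uy: "\<And>z. z \<in> U \<Longrightarrow> dir_deriv \<i> u differentiable (at z)"
    and lap: "\<And>z. z \<in> U \<Longrightarrow> dir_deriv 1 (dir_deriv 1 u) z + dir_deriv \<i> (dir_deriv \<i> u) z = 0"
    using assms by (auto simp: harmonic_on_def C2_on_def laplacian_def)
  show ?thesis unfolding holomorphic_on_open[OF U]
  proof
    fix z assume z: "z \<in> U"
    let ?p = "dir_deriv 1 (dir_deriv 1 u) z" and ?q = "dir_deriv \<i> (dir_deriv 1 u) z"
    have yx: "dir_deriv 1 (dir_deriv \<i> u) z = ?q"
      using dir_deriv_commute[OF U z u ux[OF z] uy[OF z]] by simp
    have yy: "dir_deriv \<i> (dir_deriv \<i> u) z = - ?p" using lap[OF z] by simp
    have "((\<lambda>z. dir_deriv 1 u z *\<^sub>R 1 + (- dir_deriv \<i> u z) *\<^sub>R \<i>) has_derivative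
      (\<lambda>h. (Re h * ?p + Im h * ?q) *\<^sub>R 1 + (- (Re h * ?q + Im h * (- ?p))) *\<^sub>R \<i>)) (at z)"
      using ux[OF z] uy[OF z] unfolding frechet_derivative_works
      by (intro has_derivative_add has_derivative_scaleR_left has_derivative_minus)
         (simp_all add: frechet_derivative_eq_dir_deriv[OF ux[OF z], abs_def]
            frechet_derivative_eq_dir_deriv[OF uy[OF z], abs_def] yx yy)
    moreover have "(\<lambda>z. dir_deriv 1 u z *\<^sub>R 1 + (- dir_deriv \<i> u z) *\<^sub>R \<i>) =
      (\<lambda>z. Complex (dir_deriv 1 u z) (- dir_deriv \<i> u z))"
      by (auto simp: complex_eq_iff)
    moreover have "(\<lambda>h. (Re h * ?p + Im h * ?q) *\<^sub>R 1 + (- (Re h * ?q + Im h * (- ?p))) *\<^sub>R \<i>)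
      = (*) (Complex ?p (- ?q))"
      by (auto simp: complex_eq_iff)
    ultimately show "\<exists>f'. ((\<lambda>z. Complex (dir_deriv 1 u z) (- dir_deriv \<i> u z)) has_field_derivative f') (at z)"
      unfolding has_field_derivative_def by metis
  qed
qed

text \<open>On a convex open set the holomorphic gradient has a primitive \<open>H\<close>. The
  difference of \<open>u\<close> and \<open>Re H\<close> has zero derivative, hence is a constant,
  which is added to \<open>H\<close>. The last conclusion lets derivatives of \<open>u\<close> be
  read off from \<open>deriv G\<close>.\<close>

lemma harmonic_on_real_part:
  assumes u: "harmonic_on U u" and U: "convex U"
  obtains G where "G holomorphic_on U" "\<And>z. z \<in> U \<Longrightarrow> u z = Re (G z)"
    "\<And>z h. z \<in> U \<Longrightarrow> Re (h * deriv G z) = frechet_derivative u (at z) h"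
proof (cases "U = {}")
  case True
  with that show ?thesis by (metis empty_iff holomorphic_on_empty)
next
  case False
  then obtain z0 where z0: "z0 \<in> U" by auto
  have oU: "open U" and du: "\<And>z. z \<in> U \<Longrightarrow> u differentiable (at z)"
    using u by (auto simp: harmonic_on_def C2_on_def)
  let ?g = "\<lambda>z. Complex (dir_deriv 1 u z) (- dir_deriv \<i> u z)"
  obtain H where "\<And>z. z \<in> U \<Longrightarrow> (H has_field_derivative ?g z) (at z within U)"
    using holomorphic_convex_primitive'[OF U oU harmonic_gradient_holomorphic[OF u]] by blast
  then have H: "(H has_field_derivative ?g z) (at z)" if "z \<in> U" for z
    using that oU by (metis at_within_open)
  have gr: "Re (h * ?g z) = frechet_derivative u (at z) h" if "z \<in> U" for z h
    using frechet_derivative_eq_dir_deriv[OF du[OF that]] by simp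
  have "((\<lambda>z. u z - Re (H z)) has_derivative (\<lambda>h. 0)) (at z within U)" if z: "z \<in> U" for z
  proof -
    have "((\<lambda>z. Re (H z)) has_derivative (\<lambda>h. Re (?g z * h))) (at z)"
      by (rule bounded_linear.has_derivative[OF bounded_linear_Re])
         (use H[OF z] in \<open>simp add: has_field_derivative_def\<close>)
    moreover have "(u has_derivative frechet_derivative u (at z)) (at z)"
      using du[OF z] by (simp add: frechet_derivative_works)
    ultimately have "((\<lambda>z. u z - Re (H z)) has_derivative
        (\<lambda>h. frechet_derivative u (at z) h - Re (?g z * h))) (at z)"
      by (intro has_derivative_diff)
    then show ?thesis using gr[OF z] by (simp add: mult.commute has_derivative_at_withinI)
  qed
  from has_derivative_zero_constant[OF U this]
  obtain c where c: "\<And>z. z \<in> U \<Longrightarrow> u z - Re (H z) = c" by blast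
  define G where "G z = H z + of_real c" for z
  have G: "(G has_field_derivative ?g z) (at z)" if "z \<in> U" for z
    unfolding G_def using H[OF that] by (auto intro!: derivative_eq_intros)
  show ?thesis
  proof (rule that[of G])
    show "G holomorphic_on U" using G oU by (auto simp: holomorphic_on_open)
    show "u z = Re (G z)" if "z \<in> U" for z using c[OF that] by (simp add: G_def)
    show "Re (h * deriv G z) = frechet_derivative u (at z) h" if "z \<in> U" for z h
      using gr[OF that] DERIV_imp_deriv[OF G[OF that]] by simp
  qed
qed

text \<open>These are the Fourier coefficients of index 0, 1 and -1 on a circle. They come from
  Cauchy's formulas for the value and the first derivative at 0, and from Cauchy's theorem.\<close>

lemma holomorphic_circle_integrals:
  fixes G :: "complex \<Rightarrow> complex" and \<rho> :: real
  assumes G: "G holomorphic_on ball 0 R" and \<rho>: "0 < \<rho>" "\<rho> < R"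
  shows "((\<lambda>t. G (\<rho> * cis t)) has_integral (2 * pi * G 0)) {0..2*pi}"
    and "((\<lambda>t. G (\<rho> * cis t) * cis (-t)) has_integral (2 * pi * \<rho> * deriv G 0)) {0..2*pi}"
    and "((\<lambda>t. G (\<rho> * cis t) * cis t) has_integral 0) {0..2*pi}"
proof -
  have sub: "cball 0 \<rho> \<subseteq> ball 0 R" using \<rho> by auto
  have Gc: "G holomorphic_on cball 0 \<rho>" using G sub by (rule holomorphic_on_subset)
  have ci: "continuous_on (cball 0 \<rho>) G" using Gc by (rule holomorphic_on_imp_continuous_on)
  have Gb: "G holomorphic_on ball 0 \<rho>" using Gc by (rule holomorphic_on_subset) auto
  have [simp]: "complex_of_real \<rho> \<noteq> 0" "cis t \<noteq> 0" for t using \<rho> by auto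
  have circ: "circlepath 0 \<rho> = part_circlepath 0 \<rho> 0 (2*pi)" by (simp add: circlepath_def)
  have "((\<lambda>w. G w / (w - 0)) has_contour_integral (2 * of_real pi * \<i> * G 0)) (circlepath 0 \<rho>)"
    using \<rho> by (intro Cauchy_integral_circlepath ci Gb) auto
  then have "((\<lambda>t. G (\<rho> * cis t) / (\<rho> * cis t) * \<rho> * \<i> * cis t) has_integral (2 * of_real pi * \<i> * G 0)) {0..2*pi}"
    unfolding circ by (subst (asm) has_contour_integral_part_circlepath_iff) auto
  \<comment> \<open>The factor \<open>-\<i>\<close> cancels the \<open>\<i>\<close> in
    \<open>dw = \<rho> * \<i> * cis t dt\<close>. The two other integrals are normalised alike, with
    a suitable power of \<open>\<rho>\<close>.\<close>
  then have "((\<lambda>t. -\<i> * (G (\<rho> * cis t) / (\<rho> * cis t) * \<rho> * \<i> * cis t)) has_integral -\<i> * (2 * of_real pi * \<i> * G 0)) {0..2*pi}"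
    by (rule has_integral_mult_right)
  moreover have "-\<i> * (G (\<rho> * cis t) / (\<rho> * cis t) * \<rho> * \<i> * cis t) = G (\<rho> * cis t)" for t
    using \<rho> by (simp add: algebra_simps)
  ultimately show "((\<lambda>t. G (\<rho> * cis t)) has_integral (2 * pi * G 0)) {0..2*pi}"
    using \<rho> by (simp add: mult_ac)
  have "((\<lambda>w. G w / (w - 0) ^ Suc 1) has_contour_integral ((2 * pi * \<i>) / (fact 1) * (deriv ^^ 1) G 0)) (circlepath 0 \<rho>)"
    using \<rho> by (intro Cauchy_has_contour_integral_higher_derivative_circlepath ci Gb) auto
  then have "((\<lambda>t. G (\<rho> * cis t) / (\<rho> * cis t)\<^sup>2 * \<rho> * \<i> * cis t) has_integral (2 * pi * \<i> * deriv G 0)) {0..2*pi}"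
    unfolding circ by (subst (asm) has_contour_integral_part_circlepath_iff) (auto simp: power2_eq_square)
  then have "((\<lambda>t. (-\<i> * \<rho>) * (G (\<rho> * cis t) / (\<rho> * cis t)\<^sup>2 * \<rho> * \<i> * cis t)) has_integral (-\<i> * \<rho>) * (2 * pi * \<i> * deriv G 0)) {0..2*pi}"
    by (rule has_integral_mult_right)
  moreover have "(-\<i> * \<rho>) * (G (\<rho> * cis t) / (\<rho> * cis t)\<^sup>2 * \<rho> * \<i> * cis t) = G (\<rho> * cis t) * cis (-t)" for t
    unfolding cis_inverse[symmetric] using \<rho> by (simp add: field_simps power2_eq_square)
  ultimately show "((\<lambda>t. G (\<rho> * cis t) * cis (-t)) has_integral (2 * pi * \<rho> * deriv G 0)) {0..2*pi}"
    using \<rho> by (simp add: mult_ac)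
  have "(G has_contour_integral 0) (circlepath 0 \<rho>)"
    by (rule Cauchy_theorem_disc_simple[OF G]) (use \<rho> in auto)
  then have "((\<lambda>t. G (\<rho> * cis t) * \<rho> * \<i> * cis t) has_integral 0) {0..2*pi}"
    unfolding circ by (subst (asm) has_contour_integral_part_circlepath_iff) auto
  then have "((\<lambda>t. (-\<i> / \<rho>) * (G (\<rho> * cis t) * \<rho> * \<i> * cis t)) has_integral (-\<i> / \<rho>) * 0) {0..2*pi}"
    by (rule has_integral_mult_right)
  then show "((\<lambda>t. G (\<rho> * cis t) * cis t) has_integral 0) {0..2*pi}"
    using \<rho> by (simp add: field_simps)
qed

text \<open>Precomposing \<open>G\<close> with the rotation by \<open>cis \<alpha>\<close> reduces
  to \<open>\<alpha> = 0\<close>. The cosine and sine moments are then real parts of combinations of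
  the coefficients of index 1 and -1, the latter being 0.\<close>

lemma harmonic_circle_integrals:
  assumes u: "harmonic_on (ball 0 R) u" and \<rho>: "0 < \<rho>" "\<rho> < R"
  shows "((\<lambda>t. u (\<rho> * cis (\<alpha> + t))) has_integral (2 * pi * u 0)) {0..2*pi}"
    and "((\<lambda>t. cos t * u (\<rho> * cis (\<alpha> + t))) has_integral
           (pi * \<rho> * frechet_derivative u (at 0) (cis \<alpha>))) {0..2*pi}"
    and "((\<lambda>t. sin t * u (\<rho> * cis (\<alpha> + t))) has_integral
           (pi * \<rho> * frechet_derivative u (at 0) (\<i> * cis \<alpha>))) {0..2*pi}"
proof -
  obtain G where G: "G holomorphic_on ball 0 R" "\<And>z. z \<in> ball 0 R \<Longrightarrow> u z = Re (G z)"
    "\<And>z h. z \<in> ball 0 R \<Longrightarrow> Re (h * deriv G z) = frechet_derivative u (at z) h"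
    using harmonic_on_real_part[OF u convex_ball] by blast
  define H where "H z = G (cis \<alpha> * z)" for z
  have R: "0 < R" using \<rho> by simp
  have H: "H holomorphic_on ball 0 R" unfolding H_def
    by (rule holomorphic_on_compose_gen[OF _ G(1), unfolded o_def])
       (auto intro!: holomorphic_intros simp: norm_mult)
  have "(G has_field_derivative deriv G (cis \<alpha> * 0)) (at (cis \<alpha> * 0))"
    using G(1) R by (auto intro!: holomorphic_derivI[OF G(1)])
  then have "((\<lambda>z. G (cis \<alpha> * z)) has_field_derivative deriv G (cis \<alpha> * 0) * cis \<alpha>) (at 0)"
    by (rule DERIV_chain2) (auto intro!: derivative_eq_intros)
  then have dH: "deriv H 0 = deriv G 0 * cis \<alpha>"
    unfolding H_def by (intro DERIV_imp_deriv) simp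
  note I = holomorphic_circle_integrals[OF H \<rho>]
  have uH: "u (\<rho> * cis (\<alpha> + t)) = Re (H (\<rho> * cis t))" for t
    using \<rho> by (subst G(2)) (auto simp: H_def norm_mult cis_mult[symmetric] mult_ac)
  have d1: "Re (deriv H 0) = frechet_derivative u (at 0) (cis \<alpha>)"
    using G(3)[of 0 "cis \<alpha>"] R by (simp add: dH mult.commute)
  have d2: "- Im (deriv H 0) = frechet_derivative u (at 0) (\<i> * cis \<alpha>)"
    using G(3)[of 0 "\<i> * cis \<alpha>"] R by (simp add: dH algebra_simps)
  have "((\<lambda>t. Re (H (\<rho> * cis t))) has_integral Re (2 * pi * H 0)) {0..2*pi}"
    using has_integral_linear[OF I(1) bounded_linear_Re] by (simp add: o_def)
  then show "((\<lambda>t. u (\<rho> * cis (\<alpha> + t))) has_integral (2 * pi * u 0)) {0..2*pi}"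
    using R by (simp add: uH G(2) H_def)
  have "((\<lambda>t. 1/2 * Re (H (\<rho> * cis t) * cis (-t) + H (\<rho> * cis t) * cis t)) has_integral 1/2 * Re (2 * pi * \<rho> * deriv H 0 + 0)) {0..2*pi}"
    by (rule has_integral_mult_right[OF has_integral_linear[OF _ bounded_linear_Re, unfolded o_def]])
       (intro has_integral_add I)
  moreover have "1/2 * Re (H (\<rho> * cis t) * cis (-t) + H (\<rho> * cis t) * cis t) = cos t * u (\<rho> * cis (\<alpha> + t))" for t
    unfolding uH by simp
  moreover have "1/2 * Re (2 * pi * \<rho> * deriv H 0 + 0) = pi * \<rho> * frechet_derivative u (at 0) (cis \<alpha>)"
    unfolding d1[symmetric] by simp
  ultimately show "((\<lambda>t. cos t * u (\<rho> * cis (\<alpha> + t))) has_integral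
           (pi * \<rho> * frechet_derivative u (at 0) (cis \<alpha>))) {0..2*pi}"
    by (simp only:)
  \<comment> \<open>Here \<open>\<i> * (cis (-t) - cis t) = 2 * sin t\<close>, as
    \<open>cis (-t) + cis t = 2 * cos t\<close> was used for the cosine.\<close>
  have "((\<lambda>t. 1/2 * Re (\<i> * (H (\<rho> * cis t) * cis (-t) - H (\<rho> * cis t) * cis t))) has_integral 1/2 * Re (\<i> * (2 * pi * \<rho> * deriv H 0 - 0))) {0..2*pi}"
    by (rule has_integral_mult_right[OF has_integral_linear[OF _ bounded_linear_Re, unfolded o_def]])
       (intro has_integral_mult_right has_integral_diff I)
  moreover have "1/2 * Re (\<i> * (H (\<rho> * cis t) * cis (-t) - H (\<rho> * cis t) * cis t)) = sin t * u (\<rho> * cis (\<alpha> + t))" for t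
    unfolding uH by simp
  moreover have "1/2 * Re (\<i> * (2 * pi * \<rho> * deriv H 0 - 0)) = pi * \<rho> * frechet_derivative u (at 0) (\<i> * cis \<alpha>)"
    unfolding d2[symmetric] by simp
  ultimately show "((\<lambda>t. sin t * u (\<rho> * cis (\<alpha> + t))) has_integral
           (pi * \<rho> * frechet_derivative u (at 0) (\<i> * cis \<alpha>))) {0..2*pi}"
    by (simp only:)
qed

subsection \<open>The duality estimate\<close>

text \<open>The reflection of \<open>t\<close> to \<open>a + b - t\<close> preserves the integral
  and changes the sign of \<open>h\<close>, so the integral equals its own negative.\<close>

lemma has_integral_antisymmetric:
  fixes h :: "real \<Rightarrow> real"
  assumes h: "h integrable_on {a..b}" and anti: "\<And>t. h (a + b - t) = - h t"
  shows "(h has_integral 0) {a..b}"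
proof -
  obtain i where i: "(h has_integral i) {a..b}" using h by blast
  have "((\<lambda>t. h (- t)) has_integral i) {- b..- a}"
    using i by (simp only: has_integral_reflect_real)
  then have "((\<lambda>t. h (- t)) has_integral i) (cbox (- b) (- a))"
    by (simp only: cbox_interval)
  from has_integral_shift_cbox[OF this, of "- (a + b)"]
  have "((\<lambda>t. h (- (t + - (a + b)))) has_integral i) {a..b}"
    by (simp add: cbox_interval)
  moreover have "h (- (t + - (a + b))) = - h t" for t
    using anti[of t] by (simp only: minus_diff_eq diff_conv_add_uminus[symmetric])
  ultimately have "((\<lambda>t. - h t) has_integral i) {a..b}" by (simp only:)
  from has_integral_neg[OF this] have "(h has_integral - i) {a..b}" by (simp only: minus_minus)
  from has_integral_unique[OF i this] have "i = 0" by linarith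
  with i show ?thesis by (simp only:)
qed

text \<open>The weight contains only squares of cosine and sine, so it is invariant under the
  reflections that flip one of their signs. The cosine is odd about the midpoints of
  \<open>{0..pi}\<close> and \<open>{pi..2*pi}\<close>; the sine and the product are odd about
  \<open>pi\<close>.\<close>

lemma trig_weight_integrals:
  fixes l s :: real
  defines "m \<equiv> \<lambda>t. sqrt (l\<^sup>2 + (cos t)\<^sup>2 + s\<^sup>2 * (sin t)\<^sup>2)"
  assumes m: "\<And>t. 0 < m t"
  shows "((\<lambda>t. cos t / m t) has_integral 0) {0..2*pi}"
    and "((\<lambda>t. sin t / m t) has_integral 0) {0..2*pi}"
    and "((\<lambda>t. cos t * sin t / m t) has_integral 0) {0..2*pi}"
proof -
  have mc: "continuous_on S m" for S unfolding m_def by (intro continuous_intros)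
  have [simp]: "m t \<noteq> 0" for t using m[of t] by simp
  have int: "(\<lambda>t. cos t / m t) integrable_on {a..b}" "(\<lambda>t. sin t / m t) integrable_on {a..b}"
    "(\<lambda>t. cos t * sin t / m t) integrable_on {a..b}" for a b
    by (intro integrable_continuous_interval continuous_intros mc; simp)+
  have "m (0 + pi - t) = m t" "cos (0 + pi - t) = - cos t" for t by (simp_all add: m_def)
  then have *: "((\<lambda>t. cos t / m t) has_integral 0) {0..pi}"
    by (intro has_integral_antisymmetric int) (simp only: minus_divide_left)
  have "cos (pi + 2 * pi - t) = - cos t" "sin (pi + 2 * pi - t) = sin t" for t
    using cos_periodic[of "pi - t"] sin_periodic[of "pi - t"] by (simp_all add: algebra_simps)
  then have "m (pi + 2 * pi - t) = m t" "cos (pi + 2 * pi - t) = - cos t" for t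
    by (simp_all only: m_def power2_minus)
  then have "((\<lambda>t. cos t / m t) has_integral 0) {pi..2*pi}"
    by (intro has_integral_antisymmetric int) (simp only: minus_divide_left)
  from has_integral_combine[OF _ _ * this]
  show "((\<lambda>t. cos t / m t) has_integral 0) {0..2*pi}" by simp
  have "cos (0 + 2 * pi - t) = cos t" "sin (0 + 2 * pi - t) = - sin t" for t
    by simp_all
  then have r: "m (0 + 2 * pi - t) = m t" "cos (0 + 2 * pi - t) = cos t" "sin (0 + 2 * pi - t) = - sin t" for t
    by (simp_all only: m_def power2_minus)
  show "((\<lambda>t. sin t / m t) has_integral 0) {0..2*pi}"
    by (rule has_integral_antisymmetric[OF int(2)]) (simp only: r minus_divide_left)
  show "((\<lambda>t. cos t * sin t / m t) has_integral 0) {0..2*pi}"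
    by (rule has_integral_antisymmetric[OF int(3)]) (simp only: r minus_divide_left mult_minus_right)
qed

text \<open>The cross terms in \<open>(norm (k t))\<^sup>2\<close>, divided by the weight \<open>m t\<close>, are antisymmetric and
  integrate to \<open>0\<close>; so it suffices to use \<open>2 m (norm k) \<le> (norm k)\<^sup>2 + m\<^sup>2\<close> pointwise.\<close>

lemma integral_norm_trig_le:
  fixes a b e :: complex
  assumes "norm a = 1" "norm b = 1" "norm e = 1" "0 < s"
  shows "integral {0..2*pi} (\<lambda>t. norm (l *\<^sub>R e + cos t *\<^sub>R a + (s * sin t) *\<^sub>R b))
     \<le> integral {0..2*pi} (\<lambda>t. sqrt (l\<^sup>2 + (cos t)\<^sup>2 + s\<^sup>2 * (sin t)\<^sup>2))"
proof -
  define m where "m t = sqrt (l\<^sup>2 + (cos t)\<^sup>2 + s\<^sup>2 * (sin t)\<^sup>2)" for t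
  define k where "k t = l *\<^sub>R e + cos t *\<^sub>R a + (s * sin t) *\<^sub>R b" for t
  define c where "c t = (l * (e \<bullet> a)) * (cos t / m t) + (l * s * (e \<bullet> b)) * (sin t / m t)
      + (s * (a \<bullet> b)) * (cos t * sin t / m t)" for t
  have m2: "(m t)\<^sup>2 = l\<^sup>2 + (cos t)\<^sup>2 + s\<^sup>2 * (sin t)\<^sup>2" for t by (simp add: m_def)
  \<comment> \<open>Since \<open>l\<close> may be 0, positivity comes from the trigonometric terms:
    cosine and sine have no common zero, and \<open>s\<close> is positive.\<close>
  have m: "0 < m t" for t
  proof (cases "sin t = 0")
    case True
    then have "(cos t)\<^sup>2 = 1" using sin_cos_squared_add[of t] by simp
    then show ?thesis by (simp add: m_def add_pos_nonneg add_nonneg_pos)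
  next
    case False
    then show ?thesis using \<open>0 < s\<close> by (simp add: m_def add_nonneg_pos)
  qed
  have mi: "m integrable_on {0..2*pi}" unfolding m_def
    by (intro integrable_continuous_interval continuous_intros)
  have ki: "(\<lambda>t. norm (k t)) integrable_on {0..2*pi}" unfolding k_def
    by (intro integrable_continuous_interval continuous_intros)
  have ci: "(c has_integral ((l * (e \<bullet> a)) * 0 + (l * s * (e \<bullet> b)) * 0 + (s * (a \<bullet> b)) * 0)) {0..2*pi}"
    unfolding c_def m_def
    by (intro has_integral_add has_integral_mult_right trig_weight_integrals m[unfolded m_def])
  have "norm (k t) \<le> m t + c t" for t
  proof -
    have "(norm (k t))\<^sup>2 = l\<^sup>2 * (e \<bullet> e) + (cos t)\<^sup>2 * (a \<bullet> a) + s\<^sup>2 * (sin t)\<^sup>2 * (b \<bullet> b)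
       + 2 * (l * (e \<bullet> a)) * cos t + 2 * (l * s * (e \<bullet> b)) * sin t + 2 * (s * (a \<bullet> b)) * (cos t * sin t)"
      unfolding power2_norm_eq_inner k_def
      by (simp add: inner_add_left inner_add_right inner_commute power2_eq_square algebra_simps)
    also have "\<dots> = (m t)\<^sup>2 + 2 * (m t * c t)"
      using m[of t] assms by (simp add: m2 c_def dot_square_norm algebra_simps)
    finally have "2 * m t * norm (k t) \<le> 2 * m t * (m t + c t)"
      using sum_squares_bound[of "m t" "norm (k t)"] by (simp add: algebra_simps power2_eq_square)
    then show ?thesis using m[of t] by simp
  qed
  then have "integral {0..2*pi} (\<lambda>t. norm (k t)) \<le> integral {0..2*pi} (\<lambda>t. m t + c t)"
    using ki mi ci by (intro integral_le integrable_add) auto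
  also have "\<dots> = integral {0..2*pi} m"
    using mi ci by (subst integral_add) (auto simp: integral_unique)
  finally show ?thesis unfolding k_def m_def .
qed

text \<open>With \<open>X = l\<^sup>2 + (cos t)\<^sup>2\<close>, the excess of
  \<open>sqrt (X + s\<^sup>2)\<close> over \<open>sqrt X\<close> is at most
  \<open>s\<^sup>2 / sqrt (X + s\<^sup>2)\<close>. Replacing \<open>X\<close> by
  \<open>(cos t)\<^sup>2\<close> leaves a bound whose integral is
  \<open>2 * pi * s * I_fun s\<close>, which is o(s) for every \<open>l\<close>, including
  0.\<close>

lemma sqrt_weight_le:
  fixes l s t :: real
  assumes "0 < s"
  shows "sqrt (l\<^sup>2 + (cos t)\<^sup>2 + s\<^sup>2 * (sin t)\<^sup>2)
     \<le> sqrt (l\<^sup>2 + (cos t)\<^sup>2) + s * (s / sqrt (s\<^sup>2 + (cos t)\<^sup>2))"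
proof -
  define X where "X = l\<^sup>2 + (cos t)\<^sup>2"
  have X: "0 \<le> X" "(cos t)\<^sup>2 \<le> X" by (auto simp: X_def)
  have pos: "0 < s\<^sup>2 + (cos t)\<^sup>2" "0 < X + s\<^sup>2"
    using assms X by (auto intro: add_pos_nonneg add_nonneg_pos)
  have "sqrt (X + s\<^sup>2 * (sin t)\<^sup>2) \<le> sqrt (X + s\<^sup>2)"
    using abs_square_le_1[of "sin t"] by (simp add: mult_left_le)
  also have "\<dots> = X / sqrt (X + s\<^sup>2) + s\<^sup>2 / sqrt (X + s\<^sup>2)"
    using pos by (metis add_divide_distrib less_imp_le real_div_sqrt)
  also have "\<dots> \<le> sqrt X + s\<^sup>2 / sqrt (s\<^sup>2 + (cos t)\<^sup>2)"
  proof (intro add_mono divide_left_mono)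
    show "X / sqrt (X + s\<^sup>2) \<le> sqrt X"
    proof -
      have "X = sqrt X * sqrt X" using X by simp
      also have "\<dots> \<le> sqrt X * sqrt (X + s\<^sup>2)" using X by (intro mult_left_mono) auto
      finally show ?thesis using pos by (simp add: divide_le_eq)
    qed
  qed (use pos X in auto)
  finally show ?thesis by (simp add: X_def power2_eq_square)
qed

text \<open>Pair \<open>g\<close> with the trigonometric polynomial \<open>k\<close>. The given
  moments evaluate the pairing, \<open>norm (g t) \<le> 1\<close> bounds it by the integral of
  \<open>norm (k t)\<close>, and the terms \<open>2 * l * norm p\<close> on both sides
  cancel.\<close>

lemma disc_valued_moment_estimate:
  fixes g :: "real \<Rightarrow> complex"
  assumes g: "\<And>t. norm (g t) \<le> 1"
    and p: "(g has_integral (2 * pi) *\<^sub>R p) {0..2*pi}" "norm p < 1"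
    and A: "((\<lambda>t. cos t *\<^sub>R g t) has_integral pi *\<^sub>R A) {0..2*pi}"
    and B: "((\<lambda>t. sin t *\<^sub>R g t) has_integral pi *\<^sub>R B) {0..2*pi}"
    and ab: "norm a = 1" "norm b = 1" and s: "0 < s"
  shows "a \<bullet> A + s * (b \<bullet> B) \<le> M_fun (norm p) + 2 * s * I_fun s"
proof -
  obtain l where l: "0 \<le> l" and
    M: "M_fun (norm p) + 2 * l * norm p = integral {0..2*pi} (\<lambda>t. sqrt (l\<^sup>2 + (cos t)\<^sup>2)) / pi"
    using M_fun_lambda[of "norm p"] p(2) by auto
  \<comment> \<open>For \<open>p = 0\<close> any unit vector would do; the value 1 is a
    default.\<close>
  define e where "e = (if p = 0 then 1 else sgn p)"
  have e: "norm e = 1" "e \<bullet> p = norm p"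
    by (auto simp: e_def norm_sgn sgn_div_norm dot_square_norm power2_eq_square)
  define k where "k t = l *\<^sub>R e + cos t *\<^sub>R a + (s * sin t) *\<^sub>R b" for t
  have ki: "(\<lambda>t. norm (k t)) integrable_on {0..2*pi}" unfolding k_def
    by (intro integrable_continuous_interval continuous_intros)
  have "((\<lambda>t. l * (e \<bullet> g t) + a \<bullet> (cos t *\<^sub>R g t) + s * (b \<bullet> (sin t *\<^sub>R g t)))
      has_integral (l * (e \<bullet> ((2 * pi) *\<^sub>R p)) + a \<bullet> (pi *\<^sub>R A) + s * (b \<bullet> (pi *\<^sub>R B)))) {0..2*pi}"
    by (intro has_integral_add has_integral_mult_right
          has_integral_linear[OF p(1) bounded_linear_inner_right, unfolded o_def]
          has_integral_linear[OF A bounded_linear_inner_right, unfolded o_def]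
          has_integral_linear[OF B bounded_linear_inner_right, unfolded o_def])
  moreover have "l * (e \<bullet> g t) + a \<bullet> (cos t *\<^sub>R g t) + s * (b \<bullet> (sin t *\<^sub>R g t)) = k t \<bullet> g t" for t
    by (simp add: k_def inner_add_left)
  ultimately have kg: "((\<lambda>t. k t \<bullet> g t) has_integral pi * (2 * l * norm p + a \<bullet> A + s * (b \<bullet> B))) {0..2*pi}"
    by (simp add: e algebra_simps)
  have "pi * (2 * l * norm p + a \<bullet> A + s * (b \<bullet> B)) \<le> integral {0..2*pi} (\<lambda>t. norm (k t))"
  proof (rule has_integral_le[OF kg integrable_integral[OF ki]])
    show "k t \<bullet> g t \<le> norm (k t)" for t
      using norm_cauchy_schwarz[of "k t" "g t"] mult_left_mono[OF g[of t] norm_ge_zero[of "k t"]] by simp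
  qed
  also have "\<dots> \<le> integral {0..2*pi} (\<lambda>t. sqrt (l\<^sup>2 + (cos t)\<^sup>2 + s\<^sup>2 * (sin t)\<^sup>2))"
    unfolding k_def using ab e(1) s by (rule integral_norm_trig_le)
  also have "\<dots> \<le> integral {0..2*pi} (\<lambda>t. sqrt (l\<^sup>2 + (cos t)\<^sup>2) + s * (s / sqrt (s\<^sup>2 + (cos t)\<^sup>2)))"
  proof (rule integral_le)
    show "(\<lambda>t. sqrt (l\<^sup>2 + (cos t)\<^sup>2 + s\<^sup>2 * (sin t)\<^sup>2)) integrable_on {0..2*pi}"
      by (intro integrable_continuous_interval continuous_intros)
    show "(\<lambda>t. sqrt (l\<^sup>2 + (cos t)\<^sup>2) + s * (s / sqrt (s\<^sup>2 + (cos t)\<^sup>2))) integrable_on {0..2*pi}"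
      by (intro integrable_add integrable_on_mult_right I_integrable s)
         (intro integrable_continuous_interval continuous_intros)
  qed (use sqrt_weight_le[OF s] in blast)
  also have "\<dots> = integral {0..2*pi} (\<lambda>t. sqrt (l\<^sup>2 + (cos t)\<^sup>2))
      + s * integral {0..2*pi} (\<lambda>t. s / sqrt (s\<^sup>2 + (cos t)\<^sup>2))"
  proof (subst integral_add)
    show "(\<lambda>t. sqrt (l\<^sup>2 + (cos t)\<^sup>2)) integrable_on {0..2*pi}"
      by (intro integrable_continuous_interval continuous_intros)
    show "(\<lambda>t. s * (s / sqrt (s\<^sup>2 + (cos t)\<^sup>2))) integrable_on {0..2*pi}"
      by (intro integrable_on_mult_right I_integrable s)
  qed (simp del: times_divide_eq_right)
  also have "\<dots> = pi * (M_fun (norm p) + 2 * l * norm p + 2 * s * I_fun s)"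
  proof -
    have "integral {0..2*pi} (\<lambda>t. sqrt (l\<^sup>2 + (cos t)\<^sup>2)) = pi * (M_fun (norm p) + 2 * l * norm p)"
      unfolding M by simp
    then show ?thesis by (simp add: I_fun_def algebra_simps)
  qed
  finally show ?thesis by simp
qed

section \<open>Sharp derivative bound and its equality case for one component\<close>

lemma has_integral_Complex:
  assumes "(u has_integral x) S" "(v has_integral y) S"
  shows "((\<lambda>t. Complex (u t) (v t)) has_integral Complex x y) S"
proof -
  have "((\<lambda>t. of_real (u t) + \<i> * of_real (v t)) has_integral (of_real x + \<i> * of_real y)) S"
    by (intro has_integral_add has_integral_mult_right
          has_integral_linear[OF assms(1) bounded_linear_of_real, unfolded o_def]
          has_integral_linear[OF assms(2) bounded_linear_of_real, unfolded o_def])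
  then show ?thesis by (simp add: Complex_eq)
qed

lemma unit_disc_eq_ball: "unit_disc = ball 0 1"
  by (auto simp: unit_disc_def)

text \<open>The real differential \<open>D\<close> is a parameter given by its real and imaginary
  parts, so that a coordinate of the differential of \<open>F\<close> can be substituted for it
  directly.\<close>

context
  fixes f :: "complex \<Rightarrow> complex" and D :: "complex \<Rightarrow> complex"
  assumes disc: "f ` unit_disc \<subseteq> unit_disc"
    and harm: "harmonic_on unit_disc (\<lambda>z. Re (f z))" "harmonic_on unit_disc (\<lambda>z. Im (f z))"
    and D: "\<And>v. D v = Complex (frechet_derivative (\<lambda>z. Re (f z)) (at 0) v)
                              (frechet_derivative (\<lambda>z. Im (f z)) (at 0) v)"
begin

lemma norm_centre_lt_1: "norm (f 0) < 1"
proof -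
  have "f 0 \<in> unit_disc" using disc by (metis centre_in_ball image_subset_iff unit_disc_eq_ball zero_less_one)
  then show ?thesis by (simp add: unit_disc_def)
qed

lemma directional_estimate:
  assumes ab: "norm a = 1" "norm b = 1" and s: "0 < s"
  shows "a \<bullet> D (cis \<alpha>) + s * (b \<bullet> D (\<i> * cis \<alpha>)) \<le> M_fun (norm (f 0)) + 2 * s * I_fun s"
\<comment> \<open>It suffices to prove the bound with the left side multiplied by any
  \<open>\<rho>\<close> in (0,1). This factor arises from the first Fourier coefficients on the
  circle of radius \<open>\<rho>\<close>, so no boundary values of \<open>f\<close> enter.\<close>
proof (rule field_le_mult_one_interval)
  fix \<rho> :: real
  assume \<rho>: "0 < \<rho>" "\<rho> < 1"
  note Re_int = harmonic_circle_integrals[OF harm(1)[unfolded unit_disc_eq_ball] \<rho>, of \<alpha>]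
  note Im_int = harmonic_circle_integrals[OF harm(2)[unfolded unit_disc_eq_ball] \<rho>, of \<alpha>]
  have "a \<bullet> (\<rho> *\<^sub>R D (cis \<alpha>)) + s * (b \<bullet> (\<rho> *\<^sub>R D (\<i> * cis \<alpha>))) \<le> M_fun (norm (f 0)) + 2 * s * I_fun s"
  proof (rule disc_valued_moment_estimate[OF _ _ norm_centre_lt_1 _ _ ab s])
    let ?g = "\<lambda>t. f (\<rho> * cis (\<alpha> + t))"
    show "norm (?g t) \<le> 1" for t
    proof -
      have "\<rho> * cis (\<alpha> + t) \<in> unit_disc" using \<rho> by (simp add: unit_disc_def norm_mult)
      then have "?g t \<in> unit_disc" using disc by blast
      then show ?thesis by (simp add: unit_disc_def)
    qed
    have scaleR: "c *\<^sub>R z = Complex (c * Re z) (c * Im z)" for c z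
      by (simp add: complex_eq_iff)
    have D': "pi *\<^sub>R \<rho> *\<^sub>R D v = Complex (pi * \<rho> * frechet_derivative (\<lambda>z. Re (f z)) (at 0) v)
        (pi * \<rho> * frechet_derivative (\<lambda>z. Im (f z)) (at 0) v)" for v
      unfolding D by (simp add: complex_eq_iff)
    show "(?g has_integral (2 * pi) *\<^sub>R f 0) {0..2*pi}"
      using has_integral_Complex[OF Re_int(1) Im_int(1)] by (simp only: scaleR complex.collapse)
    show "((\<lambda>t. cos t *\<^sub>R ?g t) has_integral pi *\<^sub>R \<rho> *\<^sub>R D (cis \<alpha>)) {0..2*pi}"
      using has_integral_Complex[OF Re_int(2) Im_int(2)] unfolding D' by (simp only: scaleR)
    show "((\<lambda>t. sin t *\<^sub>R ?g t) has_integral pi *\<^sub>R \<rho> *\<^sub>R D (\<i> * cis \<alpha>)) {0..2*pi}"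
      using has_integral_Complex[OF Re_int(3) Im_int(3)] unfolding D' by (simp only: scaleR)
  qed
  then show "\<rho> * (a \<bullet> D (cis \<alpha>) + s * (b \<bullet> D (\<i> * cis \<alpha>))) \<le> M_fun (norm (f 0)) + 2 * s * I_fun s"
    by (simp add: algebra_simps)
qed

text \<open>Take \<open>a\<close> in the direction of \<open>D (cis \<alpha>)\<close> and let
  \<open>s\<close> tend to 0 in the directional estimate.\<close>

lemma norm_D_cis_le: "norm (D (cis \<alpha>)) \<le> M_fun (norm (f 0))"
proof (cases "D (cis \<alpha>) = 0")
  case True
  then show ?thesis using M_fun_pos[of "norm (f 0)"] norm_centre_lt_1 by simp
next
  case False
  let ?a = "sgn (D (cis \<alpha>))" and ?s = "\<lambda>n. 1 / real (Suc n)"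
  have s: "?s \<longlonglongrightarrow> 0" by (rule lim_1_over_n[THEN LIMSEQ_Suc])
  have "?a \<bullet> D (cis \<alpha>) + 0 * (1 \<bullet> D (\<i> * cis \<alpha>)) \<le> M_fun (norm (f 0)) + 2 * 0 * 0"
  proof (rule LIMSEQ_le)
    show "(\<lambda>n. ?a \<bullet> D (cis \<alpha>) + ?s n * (1 \<bullet> D (\<i> * cis \<alpha>))) \<longlonglongrightarrow> ?a \<bullet> D (cis \<alpha>) + 0 * (1 \<bullet> D (\<i> * cis \<alpha>))"
      by (intro tendsto_intros s)
    show "(\<lambda>n. M_fun (norm (f 0)) + 2 * ?s n * I_fun (?s n)) \<longlonglongrightarrow> M_fun (norm (f 0)) + 2 * 0 * 0"
      by (intro tendsto_intros s I_fun_seq_tendsto_0)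
    show "\<exists>N. \<forall>n\<ge>N. ?a \<bullet> D (cis \<alpha>) + ?s n * (1 \<bullet> D (\<i> * cis \<alpha>)) \<le> M_fun (norm (f 0)) + 2 * ?s n * I_fun (?s n)"
      by (intro exI allI impI directional_estimate) (use False in \<open>simp_all add: norm_sgn\<close>)
  qed
  moreover have "?a \<bullet> D (cis \<alpha>) = norm (D (cis \<alpha>))"
    using False by (simp add: sgn_div_norm dot_square_norm power2_eq_square)
  ultimately show ?thesis by simp
qed

text \<open>With equality the terms of order 0 in \<open>s\<close> cancel. Dividing the rest by
  \<open>s\<close> leaves \<open>norm (D (\<i> * cis \<alpha>)) \<le> 2 * I_fun s\<close>, and the
  right side tends to 0 along \<open>s = 1 / real (Suc n)\<close>.\<close>

lemma D_orthogonal_eq_0: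
  assumes eq: "norm (D (cis \<alpha>)) = M_fun (norm (f 0))"
  shows "D (\<i> * cis \<alpha>) = 0"
proof (rule ccontr)
  assume B: "D (\<i> * cis \<alpha>) \<noteq> 0"
  have A: "D (cis \<alpha>) \<noteq> 0"
    using eq M_fun_pos[of "norm (f 0)"] norm_centre_lt_1 by auto
  have sgn: "sgn x \<bullet> x = norm x" for x :: complex
    by (cases "x = 0") (simp_all add: sgn_div_norm dot_square_norm power2_eq_square)
  have "norm (D (\<i> * cis \<alpha>)) \<le> 2 * I_fun (1 / real (Suc n))" for n
  proof -
    let ?s = "1 / real (Suc n)"
    have s: "0 < ?s" by simp
    have "?s * norm (D (\<i> * cis \<alpha>)) \<le> ?s * (2 * I_fun ?s)"
      using directional_estimate[OF _ _ s, of "sgn (D (cis \<alpha>))" "sgn (D (\<i> * cis \<alpha>))" \<alpha>] A B eq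
      by (simp add: norm_sgn sgn del: of_nat_Suc)
    then show ?thesis using s mult_le_cancel_left_pos by blast
  qed
  then have "norm (D (\<i> * cis \<alpha>)) \<le> 2 * 0"
    by (intro LIMSEQ_le_const[OF tendsto_mult[OF tendsto_const I_fun_seq_tendsto_0]] exI allI impI)
  with B show False by simp
qed

end

section \<open>From the components to the map into the polydisc\<close>

lemma onorm_attained_on_circle:
  fixes L :: "complex \<Rightarrow> 'a::real_normed_vector"
  assumes "bounded_linear L"
  obtains \<alpha> where "norm (L (cis \<alpha>)) = onorm L"
proof -
  interpret L: bounded_linear L by fact
  have "continuous_on (sphere 0 1) (\<lambda>z. norm (L z))"
    by (intro continuous_intros L.continuous_on)
  \<comment> \<open>Compactness of the circle gives a maximiser \<open>z\<close>; homogeneity then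
    makes the maximum equal to the operator norm.\<close>
  moreover have "compact (sphere (0::complex) 1)" "sphere (0::complex) 1 \<noteq> {}" by auto
  ultimately obtain z where z: "z \<in> sphere 0 1" "\<And>w. w \<in> sphere 0 1 \<Longrightarrow> norm (L w) \<le> norm (L z)"
    using continuous_attains_sup by metis
  have "onorm L \<le> norm (L z)"
  proof (rule onorm_le)
    fix x
    show "norm (L x) \<le> norm (L z) * norm x"
    proof (cases "x = 0")
      case False
      have "L x = norm x *\<^sub>R L (sgn x)" using False by (simp flip: L.scaleR add: sgn_div_norm)
      then show ?thesis using z(2)[of "sgn x"] False
        by (simp add: norm_sgn mult.commute mult_left_mono)
    qed (simp add: L.zero)
  qed
  moreover have "norm (L z) \<le> onorm L" using onorm[OF assms, of z] z(1) by simp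
  moreover have "z = cis (Arg z)" 
    using z(1) by (subst cis_Arg) (auto simp: sgn_div_norm)
  ultimately show ?thesis using that[of "Arg z"] by simp
qed

text \<open>Harmonicity speaks of real and imaginary parts of the coordinates only. Testing against
  the real basis vectors \<open>axis j 1\<close> and \<open>axis j \<i>\<close> shows that
  \<open>F\<close> itself is differentiable, which is what gives \<open>frechet_derivative F\<close>
  a meaning.\<close>

lemma harmonic_map_frechet_derivative:
  fixes F :: "complex \<Rightarrow> complex ^ 'n"
  assumes "harmonic_map_on U F" "z \<in> U"
  shows "bounded_linear (frechet_derivative F (at z))"
    and "frechet_derivative F (at z) v $ j =
      Complex (frechet_derivative (\<lambda>z. Re (F z $ j)) (at z) v) (frechet_derivative (\<lambda>z. Im (F z $ j)) (at z) v)"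
proof -
  define L where "L v = (\<chi> j. Complex (frechet_derivative (\<lambda>z. Re (F z $ j)) (at z) v)
      (frechet_derivative (\<lambda>z. Im (F z $ j)) (at z) v))" for v
  have d: "((\<lambda>z. Re (F z $ j)) has_derivative frechet_derivative (\<lambda>z. Re (F z $ j)) (at z)) (at z)"
    "((\<lambda>z. Im (F z $ j)) has_derivative frechet_derivative (\<lambda>z. Im (F z $ j)) (at z)) (at z)" for j
    using assms by (auto simp: harmonic_map_on_def harmonic_on_def C2_on_def frechet_derivative_works)
  have "(F has_derivative L) (at z)"
    unfolding has_derivative_componentwise_within[of F]
  proof
    fix i :: "complex ^ 'n" assume "i \<in> Basis"
    then obtain j b where "i = axis j b" "b \<in> {1, \<i>}" by (auto simp: Basis_vec_def Basis_complex_def)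
    then show "((\<lambda>x. F x \<bullet> i) has_derivative (\<lambda>x. L x \<bullet> i)) (at z)"
      using d[of j] by (auto simp: inner_axis L_def)
  qed
  then have "frechet_derivative F (at z) = L" "bounded_linear L"
    by (auto simp: frechet_derivative_at[symmetric] has_derivative_bounded_linear)
  then show "bounded_linear (frechet_derivative F (at z))"
    "frechet_derivative F (at z) v $ j =
      Complex (frechet_derivative (\<lambda>z. Re (F z $ j)) (at z) v) (frechet_derivative (\<lambda>z. Im (F z $ j)) (at z) v)"
    by (auto simp: L_def)
qed

theorem corollary11p2:
  fixes F :: "complex \<Rightarrow> complex ^ 'n" and p :: "complex ^ 'n"
  assumes "F ` unit_disc \<subseteq> unit_polydisc"
    and "harmonic_map_on unit_disc F"
    and "F 0 = p"
    and "onorm (frechet_derivative F (at 0)) = sqrt (\<Sum>j\<in>UNIV. (M_fun (cmod (p $ j)))\<^sup>2)"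
  shows "(\<exists>(\<alpha>::real) (W :: complex ^ 'n).
            W \<noteq> 0 \<and>
            (\<forall>\<theta>::real. frechet_derivative F (at 0) (cis \<theta>) = cos (\<theta> - \<alpha>) *\<^sub>R W) \<and>
            (\<forall>j. cmod (W $ j) = M_fun (cmod (p $ j)))) \<and>
         dim (range (frechet_derivative F (at 0))) = 1"
proof -
  define L where "L = frechet_derivative F (at 0)"
  have "0 \<in> unit_disc" by (simp add: unit_disc_def)
  note L = harmonic_map_frechet_derivative[OF assms(2) this, folded L_def]
  interpret L: bounded_linear L by (rule L(1))
  have comp: "(\<lambda>z. F z $ j) ` unit_disc \<subseteq> unit_disc" 
    "harmonic_on unit_disc (\<lambda>z. Re (F z $ j))" "harmonic_on unit_disc (\<lambda>z. Im (F z $ j))" for j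
    using assms(1,2) by (auto simp: unit_polydisc_def harmonic_map_on_def)
  have le: "norm (L (cis \<theta>) $ j) \<le> M_fun (cmod (p $ j))" for \<theta> j
    using norm_D_cis_le[OF comp L(2)] assms(3) by simp
  obtain \<alpha> where \<alpha>: "norm (L (cis \<alpha>)) = onorm L" using onorm_attained_on_circle[OF L(1)] .
  define W where "W = L (cis \<alpha>)"
  \<comment> \<open>The sums agree by the hypothesis on the operator norm, while \<open>le\<close>
    compares them term by term; hence every pair of terms agrees.\<close>
  have "(\<Sum>j\<in>UNIV. (norm (W $ j))\<^sup>2) = (\<Sum>j\<in>UNIV. (M_fun (cmod (p $ j)))\<^sup>2)"
    using \<alpha> assms(4) by (simp add: W_def L_def norm_vec_def L2_set_def)
  then have sq: "(norm (W $ j))\<^sup>2 = (M_fun (cmod (p $ j)))\<^sup>2" for j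
    by (rule sum_mono_inv) (auto simp: W_def intro: power_mono le)
  have M: "0 < M_fun (cmod (p $ j))" for j
    using norm_centre_lt_1[OF comp L(2)] assms(3) by (intro M_fun_pos) auto
  have W: "norm (W $ j) = M_fun (cmod (p $ j))" for j
    using sq[of j] M[of j] by (simp add: power2_eq_iff_nonneg)
  \<comment> \<open>Every component is extremal in the same direction \<open>cis \<alpha>\<close>,
    so the equality case applies to all of them at once.\<close>
  have orth: "L (\<i> * cis \<alpha>) = 0"
    using D_orthogonal_eq_0[OF comp L(2)] W assms(3) by (simp add: vec_eq_iff W_def)
  \<comment> \<open>Expand \<open>z\<close> in the orthonormal basis \<open>cis \<alpha>\<close>,
    \<open>\<i> * cis \<alpha>\<close>: only the first coordinate survives under \<open>L\<close>,
    and for \<open>z = cis \<theta>\<close> it is \<open>cos (\<theta> - \<alpha>)\<close>.\<close>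
  have Lz: "L z = (Re (z * cis (- \<alpha>))) *\<^sub>R W" for z
  proof -
    have "z = (z * cis (- \<alpha>)) * cis \<alpha>" by (simp add: mult.assoc cis_mult)
    also have "\<dots> = Re (z * cis (- \<alpha>)) *\<^sub>R cis \<alpha> + Im (z * cis (- \<alpha>)) *\<^sub>R (\<i> * cis \<alpha>)"
      by (subst (1) complex_eq) (simp add: algebra_simps scaleR_conv_of_real)
    finally have "L z = L (Re (z * cis (- \<alpha>)) *\<^sub>R cis \<alpha> + Im (z * cis (- \<alpha>)) *\<^sub>R (\<i> * cis \<alpha>))"
      by (rule arg_cong)
    then show ?thesis by (simp only: L.add L.scaleR orth W_def[symmetric] scaleR_zero_right add_0_right)
  qed
  have "W \<noteq> 0" using W M by (metis norm_zero order_less_irrefl zero_index)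
  moreover have "L (cis \<theta>) = cos (\<theta> - \<alpha>) *\<^sub>R W" for \<theta>
    by (simp add: Lz cis_mult)
  moreover have "range L = span {W}"
  proof -
    have "c *\<^sub>R W = L (c *\<^sub>R cis \<alpha>)" for c by (simp only: L.scaleR W_def)
    then have "range (\<lambda>c. c *\<^sub>R W) \<subseteq> range L" by blast
    moreover have "range L \<subseteq> range (\<lambda>c. c *\<^sub>R W)" using Lz by blast
    ultimately show ?thesis by (simp add: span_singleton)
  qed
  then have "dim (range L) = 1" using \<open>W \<noteq> 0\<close> by simp
  ultimately show ?thesis using W unfolding L_def by blast
qed

end
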